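(* Let $\hat{A}\in\mathbb{DC}^{n\times n}$ with $r=\operatorname{ARank}(\hat{A})$, and let $$\hat A=\hat U\begin{bmatrix}\Sigma_1&0\\0&\Sigma_2\end{bmatrix}\hat V^*,\qquad \hat{A}^{N}=\hat V\begin{bmatrix}\Sigma_1^{-1}&0\\0&0\end{bmatrix}\hat U^*$$ be a dual SVD of $\hat A$ and the resulting expression of $\hat A^N$, with $\hat U,\hat V\in\mathbb{DC}_n^U$, $\Sigma_1=\Sigma_{1s}+\epsilon\Sigma_{1d}=\operatorname{diag}(\mu_1,\ldots,\mu_r)$ and $\mu_1\ge\cdots\ge\mu_r$ positive appreciable dual numbers. Then $$\hat{A}^{N}=\hat{U}\left(\begin{bmatrix}K_1^*\Sigma_1^{-1}&0\\L_1^*\Sigma_1^{-1}&0\end{bmatrix}+\epsilon\begin{bmatrix}K_2^*\Sigma_1^{-1}&0\\L_2^*\Sigma_1^{-1}&0\end{bmatrix}\right)\hat{U}^*$$ $$=\hat{U}\left(\begin{bmatrix}K_1^*\Sigma_{1s}^{-1}&0\\L_1^*\Sigma_{1s}^{-1}&0\end{bmatrix}+\epsilon\begin{bmatrix}K_2^*\Sigma_{1s}^{-1}-K_1^*\Sigma_{1s}^{-2}\Sigma_{1d}&0\\L_2^*\Sigma_{1s}^{-1}-L_1^*\Sigma_{1s}^{-2}\Sigma_{1d}&0\end{bmatrix}\right)\hat{U}^*$$ for some $K_1,K_2\in\mathbb{C}^{r\times r}$ and $L_1,L_2\in\mathbb{C}^{r\times(n-r)}$ satisfying $$K_1K_1^*+L_1L_1^*=I_r,\qquad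 K_1K_2^*+K_2K_1^*+L_1L_2^*+L_2L_1^*=0.$$
   Context: Dual complex numbers are $\hat a=a_s+\epsilon a_d$ with $a_s,a_d\in\mathbb{C}$, $\epsilon\ne0$, $\epsilon^2=0$, $\epsilon$ commuting with scalars; they form the ring $\mathbb{DC}$. A dual number is such an element with $a_s,a_d\in\mathbb{R}$. It is appreciable if $a_s\neq0$ and infinitesimal if $a_s=0$. Dual numbers are totally ordered by: $\hat a\le\hat b$ iff $a_s<b_s$, or $a_s=b_s$ and $a_d\le b_d$; $\hat a$ is positive if $\hat a>0$. A matrix $\hat A\in\mathbb{DC}^{m\times n}$ is written $\hat A=A_s+\epsilon A_d$ with $A_s,A_d\in\mathbb{C}^{m\times n}$; $\hat A^*=A_s^*+\epsilon A_d^*$. $\mathbb{DC}_n^U$ is the set of $\hat U\in\mathbb{DC}^{n\times n}$ with $\hat U^{-1}=\hat U^*$. Dual SVD: every $\hat A\in\mathbb{DC}^{n\times n}$ can be written $\hat A=\hat U\begin{bmatrix}\Sigma_1&0\\0&\Sigma_2\end{bmatrix}\hat V^*$ with $\hat U,\hat V\in\mathbb{DC}_n^U$, $\Sigma_1=\operatorname{diag}(\mu_1,\ldots,\mu_r)$ with $\mu_1\ge\dots\ge\mu_r$ positive appreciable dual numbers, and $\Sigma_2=\operatorname{diag}(\mu_{r+1},\ldots,\mu_t,0,\ldots,0)$ with $\mu_{r+1}\ge\dots\ge\mu_t$ positive infinitesimal dual numbers; the $\mu_i$ are uniquely determined by $\hat A$, and $\operatorname{ARank}(\hat A)=r=\operatorname{rank}(A_s)$.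 The essential part of $\hat A$ is $\hat A_e=\hat U\begin{bmatrix}\Sigma_1&0\\0&0\end{bmatrix}\hat V^*$. The new dual Moore-Penrose inverse (NDMPI) $\hat A^N$ is the unique dual matrix $\hat X$ satisfying $\hat A\hat X\hat A=\hat A_e$, $\hat X\hat A\hat X=\hat X$, $(\hat A\hat X)^*=\hat A\hat X$, $(\hat X\hat A)^*=\hat X\hat A$. It always exists and, for any dual SVD $\hat A=\hat U\begin{bmatrix}\Sigma_1&0\\0&\Sigma_2\end{bmatrix}\hat V^*$ with $\hat U,\hat V\in\mathbb{DC}_n^U$, $\Sigma_1=\operatorname{diag}(\mu_1,\ldots,\mu_r)$ having positive appreciable dual number entries $\mu_1\ge\dots\ge\mu_r$, and $\Sigma_2=\operatorname{diag}(\mu_{r+1},\ldots,\mu_t,0,\ldots,0)$ with positive infinitesimal dual numbers $\mu_{r+1}\ge\dots\ge\mu_t$, equals $\hat V\begin{bmatrix}\Sigma_1^{-1}&0\\0&0\end{bmatrix}\hat U^*$ (known fact). *)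

theory Defs
  imports "Jordan_Normal_Form.Schur_Decomposition" "Jordan_Normal_Form.DL_Rank"
begin

section \<open>Dual numbers over a coefficient ring\<close>

text \<open>\<open>Dual a b\<close> is $a + \epsilon b$. Dual complex numbers are \<open>complex dual_num\<close>,
  dual numbers are \<open>real dual_num\<close>.\<close>

datatype 'a dual_num = Dual (std_part: 'a) (dual_part: 'a)

instantiation dual_num :: (comm_ring_1) comm_ring_1
begin

definition "0 = Dual 0 0"
definition "1 = Dual 1 0"
definition "x + y = Dual (std_part x + std_part y) (dual_part x + dual_part y)"
definition "- x = Dual (- std_part x) (- dual_part x)"
definition "x - y = Dual (std_part x - std_part y) (dual_part x - dual_part y)"
definition "x * y =
  Dual (std_part x * std_part y) (std_part x * dual_part y + dual_part x * std_part y)"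

instance
  by standard
    (auto simp: zero_dual_num_def one_dual_num_def plus_dual_num_def uminus_dual_num_def
      minus_dual_num_def times_dual_num_def algebra_simps)

end

instantiation dual_num :: (linorder) linorder
begin

definition "x \<le> y \<longleftrightarrow>
  std_part x < std_part y \<or> std_part x = std_part y \<and> dual_part x \<le> dual_part y"

definition "x < y \<longleftrightarrow> x \<le> y \<and> \<not> y \<le> (x :: 'a dual_num)"

instance
  by standard (auto simp: less_eq_dual_num_def less_dual_num_def dual_num.expand)

end

definition eps :: "'a::comm_ring_1 dual_num" where
  "eps = Dual 0 1"

definition scalar_dual :: "'a::zero \<Rightarrow> 'a dual_num" where
  "scalar_dual a = Dual a 0"

lemma eps_squared: "eps * eps = 0"
  by (simp add: eps_def times_dual_num_def zero_dual_num_def)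

lemma dual_num_decompose: "x = scalar_dual (std_part x) + eps * scalar_dual (dual_part x)"
  by (cases x) (simp add: eps_def scalar_dual_def times_dual_num_def plus_dual_num_def)

definition appreciable :: "'a::zero dual_num \<Rightarrow> bool" where
  "appreciable x \<longleftrightarrow> std_part x \<noteq> 0"

definition infinitesimal :: "'a::zero dual_num \<Rightarrow> bool" where
  "infinitesimal x \<longleftrightarrow> std_part x = 0"

abbreviation complex_dual :: "real dual_num \<Rightarrow> complex dual_num" where
  "complex_dual \<equiv> map_dual_num complex_of_real"


section \<open>Dual complex matrices\<close>

abbreviation std_mat :: "'a dual_num mat \<Rightarrow> 'a mat" where
  "std_mat \<equiv> map_mat std_part"

abbreviation dual_mat :: "'a dual_num mat \<Rightarrow> 'a mat" where
  "dual_mat \<equiv> map_mat dual_part"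

abbreviation lift_mat :: "'a::zero mat \<Rightarrow> 'a dual_num mat" where
  "lift_mat \<equiv> map_mat scalar_dual"

definition dual_adjoint :: "complex dual_num mat \<Rightarrow> complex dual_num mat" where
  "dual_adjoint A =
     lift_mat (mat_adjoint (std_mat A)) + eps \<cdot>\<^sub>m lift_mat (mat_adjoint (dual_mat A))"

text \<open>The inverse of an invertible square matrix; meaningless for other matrices. It is used both
  over the complex numbers and over the dual complex numbers (which are not a field).\<close>

definition mat_inv :: "'a::semiring_1 mat \<Rightarrow> 'a mat" where
  "mat_inv A = (THE B. inverts_mat A B \<and> inverts_mat B A)"

definition dual_unitary :: "nat \<Rightarrow> complex dual_num mat set" where
  "dual_unitary n =
     {U \<in> carrier_mat n n. inverts_mat U (dual_adjoint U) \<and> inverts_mat (dual_adjoint U) U}"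

text \<open>Appreciable rank: the rank of the standard part.\<close>

definition arank :: "complex dual_num mat \<Rightarrow> nat" where
  "arank A = vec_space.rank (dim_row A) (std_mat A)"


section \<open>Dual singular value decomposition, essential part and NDMPI\<close>

text \<open>Singular values are indexed from \<open>0\<close>: \<open>\<mu> 0, \<dots>, \<mu> (r - 1)\<close> are the appreciable ones and
  \<open>\<mu> r, \<dots>, \<mu> (t - 1)\<close> the infinitesimal ones.\<close>

definition Sigma1 :: "nat \<Rightarrow> (nat \<Rightarrow> real dual_num) \<Rightarrow> complex dual_num mat" where
  "Sigma1 r \<mu> = mat_diag r (\<lambda>i. complex_dual (\<mu> i))"

definition Sigma2 ::
  "nat \<Rightarrow> nat \<Rightarrow> nat \<Rightarrow> (nat \<Rightarrow> real dual_num) \<Rightarrow> complex dual_num mat" where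
  "Sigma2 n r t \<mu> = mat_diag (n - r) (\<lambda>i. if r + i < t then complex_dual (\<mu> (r + i)) else 0)"

definition is_dual_svd ::
  "nat \<Rightarrow> complex dual_num mat \<Rightarrow> complex dual_num mat \<Rightarrow> complex dual_num mat
    \<Rightarrow> nat \<Rightarrow> nat \<Rightarrow> (nat \<Rightarrow> real dual_num) \<Rightarrow> bool" where
  "is_dual_svd n A U V r t \<mu> \<longleftrightarrow>
     U \<in> dual_unitary n \<and> V \<in> dual_unitary n \<and> r \<le> t \<and> t \<le> n \<and>
     (\<forall>i<r. 0 < \<mu> i \<and> appreciable (\<mu> i)) \<and>
     (\<forall>i j. i \<le> j \<and> j < r \<longrightarrow> \<mu> j \<le> \<mu> i) \<and>
     (\<forall>i. r \<le> i \<and> i < t \<longrightarrow> 0 < \<mu> i \<and> infinitesimal (\<mu> i)) \<and>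
     (\<forall>i j. r \<le> i \<and> i \<le> j \<and> j < t \<longrightarrow> \<mu> j \<le> \<mu> i) \<and>
     A = U * four_block_mat (Sigma1 r \<mu>) (0\<^sub>m r (n - r)) (0\<^sub>m (n - r) r) (Sigma2 n r t \<mu>)
           * dual_adjoint V"

text \<open>The essential part does not depend on the dual SVD used to compute it.\<close>

definition essential_part :: "complex dual_num mat \<Rightarrow> complex dual_num mat" where
  "essential_part A = (THE E. \<exists>U V r t \<mu>. is_dual_svd (dim_row A) A U V r t \<mu> \<and>
     E = U * four_block_mat (Sigma1 r \<mu>) (0\<^sub>m r (dim_row A - r))
               (0\<^sub>m (dim_row A - r) r) (0\<^sub>m (dim_row A - r) (dim_row A - r))
           * dual_adjoint V)"

definition ndmpi :: "complex dual_num mat \<Rightarrow> complex dual_num mat" where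
  "ndmpi A = (THE X. X \<in> carrier_mat (dim_col A) (dim_row A) \<and>
     A * X * A = essential_part A \<and> X * A * X = X \<and>
     dual_adjoint (A * X) = A * X \<and> dual_adjoint (X * A) = X * A)"

end

theory Submission
  imports Defs
begin

text \<open>The NDMPI equations are the Moore-Penrose equations of the essential part \<open>E\<close> in disguise.
  If \<open>A = E + F\<close> is the splitting of a dual SVD into its appreciable and infinitesimal terms and
  \<open>X\<close> is the Moore-Penrose inverse of \<open>E\<close>, then \<open>X F = 0 = F X\<close>. Because \<open>F\<close> is infinitesimal,
  products with \<open>F\<close> only see standard parts, and the standard part of \<open>E\<close> is that of \<open>A\<close>; hence
  \<open>X\<close> also annihilates the infinitesimal term of any other dual SVD of \<open>A\<close>. This forces the
  essential part to be unique, and then \<open>X\<close> is the NDMPI. The blocks \<open>K\<close> and \<open>L\<close> are the first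
  \<open>r\<close> rows of the unitary matrix \<open>V\<^sup>* U\<close>; the relations between them are the standard and dual parts of
  the orthonormality of these rows.\<close>

section \<open>Arithmetic of dual matrices\<close>

lemma dual_num_sel [simp]:
  "std_part 0 = 0" "dual_part 0 = 0" "std_part 1 = 1" "dual_part 1 = 0"
  "std_part (x + y) = std_part x + std_part y" "dual_part (x + y) = dual_part x + dual_part y"
  "std_part (x * y) = std_part x * std_part y"
  "dual_part (x * y) = std_part x * dual_part y + dual_part x * std_part y"
  "std_part eps = 0" "dual_part eps = 1"
  "std_part (scalar_dual a) = a" "dual_part (scalar_dual a) = 0"
  by (simp_all add: zero_dual_num_def one_dual_num_def plus_dual_num_def times_dual_num_def
      eps_def scalar_dual_def)

lemma dual_num_eq_iff: "x = y \<longleftrightarrow> std_part x = std_part y \<and> dual_part x = dual_part y"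
  by (cases x; cases y) simp

lemma dual_num_map_sel [simp]:
  "std_part (map_dual_num f x) = f (std_part x)" "dual_part (map_dual_num f x) = f (dual_part x)"
  by (cases x; simp)+

lemma std_mat_mult:
  assumes "A \<in> carrier_mat m n" "B \<in> carrier_mat n k"
  shows "std_mat (A * B) = std_mat A * std_mat B"
proof -
  interpret semiring_hom "std_part :: 'a dual_num \<Rightarrow> 'a"
    by standard simp_all
  show ?thesis using mat_hom_mult[OF assms] .
qed

lemma dual_part_sum: "dual_part (sum f S) = (\<Sum>i\<in>S. dual_part (f i))"
  by (induction S rule: infinite_finite_induct) simp_all

text \<open>Leibniz rule: on entries, the dual part is a derivation along the ring homomorphism
  \<open>std_part\<close>. Applied to a product with its adjoint, it later yields the second
  relation between the blocks.\<close>

lemma dual_mat_mult: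
  assumes "A \<in> carrier_mat m n" "B \<in> carrier_mat n k"
  shows "dual_mat (A * B) = std_mat A * dual_mat B + dual_mat A * std_mat B"
  using assms by (intro eq_matI) (auto simp: scalar_prod_def dual_part_sum sum.distrib)

text \<open>Every entry of \<open>F\<close> is a multiple of \<open>eps\<close>, so
  \<open>eps * eps = 0\<close> removes whatever the dual part of the other factor contributes. This
  permits exchanging matrices that differ only in their dual parts.\<close>

lemma mult_infinitesimal_left:
  assumes "A \<in> carrier_mat m n" "B \<in> carrier_mat m n" "F \<in> carrier_mat n k"
    and "std_mat F = 0\<^sub>m n k" and "std_mat A = std_mat B"
  shows "A * F = B * F"
proof (rule eq_matI)
  fix i j assume ij: "i < dim_row (B * F)" "j < dim_col (B * F)"
  have "std_part (F $$ (l, j)) = 0" if "l < n" for l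
    using arg_cong[OF assms(4), of "\<lambda>M. M $$ (l, j)"] assms(3) ij that by auto
  moreover have "std_part (A $$ (i, l)) = std_part (B $$ (i, l))" if "l < n" for l
    using arg_cong[OF assms(5), of "\<lambda>M. M $$ (i, l)"] assms(1,2) ij that by auto
  ultimately have "A $$ (i, l) * F $$ (l, j) = B $$ (i, l) * F $$ (l, j)" if "l < n" for l
    using that by (simp add: dual_num_eq_iff)
  then show "(A * F) $$ (i, j) = (B * F) $$ (i, j)"
    using assms(1-3) ij by (auto simp: scalar_prod_def intro!: sum.cong)
qed (use assms in auto)

lemma mult_infinitesimal_right:
  assumes "A \<in> carrier_mat n k" "B \<in> carrier_mat n k" "F \<in> carrier_mat m n"
    and "std_mat F = 0\<^sub>m m n" and "std_mat A = std_mat B"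
  shows "F * A = F * B"
proof (rule eq_matI)
  fix i j assume ij: "i < dim_row (F * B)" "j < dim_col (F * B)"
  have "std_part (F $$ (i, l)) = 0" if "l < n" for l
    using arg_cong[OF assms(4), of "\<lambda>M. M $$ (i, l)"] assms(3) ij that by auto
  moreover have "std_part (A $$ (l, j)) = std_part (B $$ (l, j))" if "l < n" for l
    using arg_cong[OF assms(5), of "\<lambda>M. M $$ (l, j)"] assms(1,2) ij that by auto
  ultimately have "F $$ (i, l) * A $$ (l, j) = F $$ (i, l) * B $$ (l, j)" if "l < n" for l
    using that by (simp add: dual_num_eq_iff)
  then show "(F * A) $$ (i, j) = (F * B) $$ (i, j)"
    using assms(1-3) ij by (auto simp: scalar_prod_def intro!: sum.cong)
qed (use assms in auto)

section \<open>Adjoints of complex and dual complex matrices\<close>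

lemma mat_adjoint_dim [simp]: "dim_row (mat_adjoint A) = dim_col A" "dim_col (mat_adjoint A) = dim_row A"
  by (simp_all add: mat_adjoint_def)

lemma mat_adjoint_index [simp]:
  "i < dim_col A \<Longrightarrow> j < dim_row A \<Longrightarrow> mat_adjoint A $$ (i, j) = conjugate (A $$ (j, i))"
  by (simp add: mat_adjoint_def mat_of_rows_index)

lemma mat_adjoint_carrier [simp]: "A \<in> carrier_mat m n \<Longrightarrow> mat_adjoint A \<in> carrier_mat n m"
  by (intro carrier_matI) simp_all

lemma dual_adjoint_dim [simp]:
  "dim_row (dual_adjoint A) = dim_col A" "dim_col (dual_adjoint A) = dim_row A"
  by (simp_all add: dual_adjoint_def)

lemma dual_adjoint_carrier [simp]: "A \<in> carrier_mat m n \<Longrightarrow> dual_adjoint A \<in> carrier_mat n m"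
  by (intro carrier_matI) simp_all

lemma dual_adjoint_index [simp]:
  "i < dim_col A \<Longrightarrow> j < dim_row A \<Longrightarrow> dual_adjoint A $$ (i, j) = map_dual_num cnj (A $$ (j, i))"
  by (simp add: dual_adjoint_def dual_num_eq_iff)

lemma std_mat_dual_adjoint: "std_mat (dual_adjoint A) = mat_adjoint (std_mat A)"
  by (rule eq_matI) simp_all

lemma dual_mat_dual_adjoint: "dual_mat (dual_adjoint A) = mat_adjoint (dual_mat A)"
  by (rule eq_matI) simp_all

lemma dual_adjoint_adjoint [simp]: "dual_adjoint (dual_adjoint A) = A"
  by (rule eq_matI) (simp_all add: dual_num_eq_iff)

text \<open>Conjugating both parts of a dual number is a ring homomorphism, and the adjoint is the
  transpose of its entrywise application; the reversal of factors comes from the transpose.\<close>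

lemma dual_adjoint_mult:
  assumes "A \<in> carrier_mat m n" "B \<in> carrier_mat n k"
  shows "dual_adjoint (A * B) = dual_adjoint B * dual_adjoint A"
proof -
  interpret semiring_hom "map_dual_num cnj"
    by standard (simp_all add: dual_num_eq_iff)
  have adj: "dual_adjoint M = transpose_mat (map_mat (map_dual_num cnj) M)" for M
    by (rule eq_matI) simp_all
  show ?thesis
    using assms by (simp add: adj mat_hom_mult[OF assms] transpose_mult[of _ m n _ k])
qed

section \<open>Uniqueness of the essential part\<close>

text \<open>This records what a dual SVD says about its two terms without mentioning
  \<open>U\<close>, \<open>V\<close> or singular values, so that different decompositions of
  \<open>A\<close> can be compared. The four equations for \<open>E\<close> and \<open>X\<close> are
  the Moore-Penrose equations.\<close>

definition appreciable_split ::
  "nat \<Rightarrow> complex dual_num mat \<Rightarrow> complex dual_num mat \<Rightarrow> complex dual_num mat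
    \<Rightarrow> complex dual_num mat \<Rightarrow> bool" where
  "appreciable_split n A E F X \<longleftrightarrow>
     E \<in> carrier_mat n n \<and> F \<in> carrier_mat n n \<and> X \<in> carrier_mat n n \<and>
     A = E + F \<and> std_mat F = 0\<^sub>m n n \<and> E * X * E = E \<and> X * E * X = X \<and>
     dual_adjoint (E * X) = E * X \<and> dual_adjoint (X * E) = X * E \<and>
     X * F = 0\<^sub>m n n \<and> F * X = 0\<^sub>m n n"

lemma appreciable_split_mult:
  assumes "appreciable_split n A E F X"
  shows "A * X = E * X" "X * A = X * E"
  using assms add_mult_distrib_mat[of E n n F X n] mult_add_distrib_mat[of X n n E n F]
  by (auto simp: appreciable_split_def)

lemma appreciable_split_std:
  assumes "appreciable_split n A E F X"
  shows "std_mat E = std_mat A"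
proof -
  have c: "E \<in> carrier_mat n n" "F \<in> carrier_mat n n" and A: "A = E + F"
    and F: "std_mat F = 0\<^sub>m n n"
    using assms by (auto simp: appreciable_split_def)
  show ?thesis
  proof (rule eq_matI)
    fix i j assume ij: "i < dim_row (std_mat A)" "j < dim_col (std_mat A)"
    then have "std_part (F $$ (i, j)) = 0"
      using arg_cong[OF F, of "\<lambda>M. M $$ (i, j)"] c A by auto
    then show "std_mat E $$ (i, j) = std_mat A $$ (i, j)"
      using c A ij by simp
  qed (use A c in auto)
qed

text \<open>By the Moore-Penrose equations the adjoint of \<open>E'\<close> ends in the factor
  \<open>E' * X'\<close> and begins with \<open>X' * E'\<close>, so it annihilates \<open>F'\<close>
  from both sides. Since \<open>F'\<close> is infinitesimal and \<open>E\<close>, \<open>E'\<close>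
  share the standard part of \<open>A\<close>, the adjoint of \<open>E\<close> does so too, and
  \<open>X\<close> has that adjoint as a factor on either side.\<close>

lemma appreciable_split_cross:
  assumes s: "appreciable_split n A E F X" and s': "appreciable_split n A E' F' X'"
  shows "X * F' = 0\<^sub>m n n" "F' * X = 0\<^sub>m n n"
proof -
  have c [simp]: "E \<in> carrier_mat n n" "F \<in> carrier_mat n n" "X \<in> carrier_mat n n"
    "E' \<in> carrier_mat n n" "F' \<in> carrier_mat n n" "X' \<in> carrier_mat n n"
    using s s' by (auto simp: appreciable_split_def)
  let ?a = dual_adjoint
  have st: "std_mat (?a E) = std_mat (?a E')"
    using appreciable_split_std[OF s] appreciable_split_std[OF s']
    by (simp add: std_mat_dual_adjoint)
  have F': "std_mat F' = 0\<^sub>m n n" using s' by (simp add: appreciable_split_def)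
  have "?a E' = ?a (E' * X' * E')" using s' by (simp add: appreciable_split_def)
  also have "\<dots> = ?a E' * ?a (E' * X')"
    by (rule dual_adjoint_mult[of _ n n _ n]) (simp_all add: mult_carrier_mat[of _ n n _ n])
  finally have 1: "?a E' = ?a E' * (E' * X')" using s' by (simp add: appreciable_split_def)
  have "?a E' = ?a (E' * (X' * E'))"
    using s' by (simp add: appreciable_split_def assoc_mult_mat[of _ n n _ n _ n] mult_carrier_mat[of _ n n _ n])
  also have "\<dots> = ?a (X' * E') * ?a E'"
    by (rule dual_adjoint_mult[of _ n n _ n]) (simp_all add: mult_carrier_mat[of _ n n _ n])
  finally have 2: "?a E' = X' * E' * ?a E'" using s' by (simp add: appreciable_split_def)
  have "?a E' * F' = ?a E' * (E' * (X' * F'))"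
    by (subst 1) (simp add: assoc_mult_mat[of _ n n _ n _ n] mult_carrier_mat[of _ n n _ n])
  then have "?a E' * F' = 0\<^sub>m n n"
    using s' by (simp add: appreciable_split_def right_mult_zero_mat[of _ n n])
  \<comment> \<open>Here the primed and unprimed splittings meet: \<open>E'\<close> is exchanged for
    \<open>E\<close> in front of the infinitesimal \<open>F'\<close>.\<close>
  then have EF: "?a E * F' = 0\<^sub>m n n"
    using mult_infinitesimal_left[OF _ _ _ F' st, of n] by simp
  have "F' * ?a E' = F' * X' * E' * ?a E'"
    by (subst 2) (simp add: assoc_mult_mat[of _ n n _ n _ n] mult_carrier_mat[of _ n n _ n])
  then have "F' * ?a E' = 0\<^sub>m n n"
    using s' by (simp add: appreciable_split_def left_mult_zero_mat[of _ n n])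
  then have FE: "F' * ?a E = 0\<^sub>m n n"
    using mult_infinitesimal_right[OF _ _ _ F' st, of n] by simp
  \<comment> \<open>Since \<open>E * X\<close> and \<open>X * E\<close> are self-adjoint, these
    equations become factorizations of \<open>X\<close> with \<open>?a E\<close> as the last and as
    the first factor, respectively.\<close>
  have X: "X = X * (E * X)" "X = X * E * X"
    using s by (simp_all add: appreciable_split_def assoc_mult_mat[of _ n n _ n _ n] mult_carrier_mat[of _ n n _ n])
  have "E * X = ?a X * ?a E" "X * E = ?a E * ?a X"
    using s by (simp_all add: appreciable_split_def flip: dual_adjoint_mult[of _ n n _ n])
  note X = X[unfolded this]
  have "X * F' = X * (?a X * (?a E * F'))"
    by (subst X(1)) (simp add: assoc_mult_mat[of _ n n _ n _ n] mult_carrier_mat[of _ n n _ n])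
  then show "X * F' = 0\<^sub>m n n" by (simp add: EF right_mult_zero_mat[of _ n n])
  have "F' * X = F' * ?a E * (?a X * X)"
    by (subst X(2)) (simp add: assoc_mult_mat[of _ n n _ n _ n] mult_carrier_mat[of _ n n _ n])
  then show "F' * X = 0\<^sub>m n n"
    unfolding FE by (simp add: left_mult_zero_mat[of _ n n] mult_carrier_mat[of _ n n _ n])
qed

text \<open>As \<open>X'\<close> annihilates \<open>F\<close> and \<open>F'\<close>, both
  \<open>X' * E\<close> and \<open>X' * E'\<close> equal \<open>X' * A\<close>; likewise
  \<open>E' * X\<close> and \<open>E * X\<close> equal \<open>A * X\<close>. Hence
  \<open>E = E * X * E = E' * X * E\<close>, and inserting this into \<open>E' = E' * X' * E\<close>
  leaves \<open>E' * X * E = E\<close>.\<close>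

lemma appreciable_split_unique:
  assumes s: "appreciable_split n A E F X" and s': "appreciable_split n A E' F' X'"
  shows "E = E'"
proof -
  have c [simp]: "E \<in> carrier_mat n n" "F \<in> carrier_mat n n" "X \<in> carrier_mat n n"
    "E' \<in> carrier_mat n n" "F' \<in> carrier_mat n n" "X' \<in> carrier_mat n n"
    and A: "A = E + F" and A': "A = E' + F'"
    using s s' by (auto simp: appreciable_split_def)
  have "X' * A = X' * E"
    using appreciable_split_cross(1)[OF s' s] mult_add_distrib_mat[of X' n n E n F] A
    by (simp add: right_add_zero_mat[of _ n n] mult_carrier_mat[of _ n n _ n])
  then have 1: "X' * E = X' * E'" using appreciable_split_mult(2)[OF s'] by simp
  have "A * X = E' * X"
    using appreciable_split_cross(2)[OF s s'] add_mult_distrib_mat[of E' n n F' X n] A'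
    by (simp add: right_add_zero_mat[of _ n n] mult_carrier_mat[of _ n n _ n])
  then have 2: "E' * X = E * X" using appreciable_split_mult(1)[OF s] by simp
  have E: "E = E' * X * E"
    using s by (simp only: 2) (simp add: appreciable_split_def)
  have "E' = E' * (X' * E)"
    using s' by (simp add: 1 appreciable_split_def assoc_mult_mat[of _ n n _ n _ n] mult_carrier_mat[of _ n n _ n])
  also have "\<dots> = E' * (X' * (E' * X * E))" by (simp flip: E)
  also have "\<dots> = (E' * X' * E') * X * E" by (simp add: assoc_mult_mat[of _ n n _ n _ n] mult_carrier_mat[of _ n n _ n])
  also have "\<dots> = E' * X * E" using s' by (simp add: appreciable_split_def)
  finally show ?thesis using E by simp
qed

text \<open>Penrose's uniqueness argument, with \<open>A * X * A = A\<close> weakened to a common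
  value of \<open>A * X * A\<close> and \<open>A * Y * A\<close>. The self-adjoint idempotents
  \<open>A * X\<close> and \<open>A * Y\<close> absorb each other, so taking adjoints makes them
  equal; the same holds for \<open>X * A\<close> and \<open>Y * A\<close>. Then
  \<open>X = X * A * X = Y * A * Y = Y\<close>.\<close>

lemma outer_inverse_unique:
  assumes c [simp]: "A \<in> carrier_mat n n" "X \<in> carrier_mat n n" "Y \<in> carrier_mat n n"
    and AXA: "A * X * A = A * Y * A"
    and X: "X * A * X = X" "dual_adjoint (A * X) = A * X" "dual_adjoint (X * A) = X * A"
    and Y: "Y * A * Y = Y" "dual_adjoint (A * Y) = A * Y" "dual_adjoint (Y * A) = Y * A"
  shows "X = Y"
proof -
  note assoc = assoc_mult_mat[of _ n n _ n _ n] mult_carrier_mat[of _ n n _ n]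
  have X': "X * (A * X) = X" and Y': "Y * (A * Y) = Y"
    using X(1) Y(1) by (simp_all add: assoc)
  have "A * X * (A * Y) = A * X * A * Y" by (simp add: assoc)
  also have "\<dots> = A * Y" unfolding AXA by (simp add: assoc Y')
  finally have 1: "A * X * (A * Y) = A * Y" .
  have "A * Y * (A * X) = A * Y * A * X" by (simp add: assoc)
  also have "\<dots> = A * X" unfolding AXA[symmetric] by (simp add: assoc X')
  finally have "dual_adjoint (A * Y * (A * X)) = A * X" using X(2) by simp
  moreover have "dual_adjoint (A * Y * (A * X)) = A * X * (A * Y)"
    using dual_adjoint_mult[of "A * Y" n n "A * X" n] X(2) Y(2)
    by (simp add: mult_carrier_mat[of _ n n _ n] del: assoc_mult_mat)
  ultimately have AX: "A * X = A * Y" using 1 by simp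
  have "Y * A * (X * A) = Y * (A * X * A)" by (simp add: assoc)
  also have "\<dots> = Y * A * Y * A" unfolding AXA by (simp add: assoc)
  finally have 2: "Y * A * (X * A) = Y * A" unfolding Y(1) .
  have "X * A * (Y * A) = X * (A * Y * A)" by (simp add: assoc)
  also have "\<dots> = X * A * X * A" unfolding AXA[symmetric] by (simp add: assoc)
  finally have "dual_adjoint (X * A * (Y * A)) = X * A"
    unfolding X(1) by (simp only: X(3))
  moreover have "dual_adjoint (X * A * (Y * A)) = Y * A * (X * A)"
    using dual_adjoint_mult[of "X * A" n n "Y * A" n] X(3) Y(3)
    by (simp add: mult_carrier_mat[of _ n n _ n] del: assoc_mult_mat)
  ultimately have XA: "X * A = Y * A" using 2 by simp
  have "X = X * A * X" by (simp only: X)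
  also have "\<dots> = Y * (A * X)" unfolding XA by (simp add: assoc)
  finally show ?thesis unfolding AX Y' .
qed

section \<open>The NDMPI from a dual SVD\<close>

text \<open>The geometric series for the inverse of a + eps b stops after the linear term: 1/a - eps
  b/a^2. With division by zero equal to zero, infinitesimal arguments are sent to 0.\<close>

definition dual_inv :: "'a::field dual_num \<Rightarrow> 'a dual_num" where
  "dual_inv x = Dual (1 / std_part x) (- dual_part x / (std_part x)\<^sup>2)"

lemma mult_dual_inv:
  assumes "appreciable x"
  shows "x * dual_inv x = 1" "dual_inv x * x = 1"
  using assms by (auto simp: dual_inv_def appreciable_def dual_num_eq_iff power2_eq_square)

lemma mat_inv_eqI:
  assumes "A \<in> carrier_mat n n" "B \<in> carrier_mat n n" "A * B = 1\<^sub>m n" "B * A = 1\<^sub>m n"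
  shows "mat_inv A = B"
  unfolding mat_inv_def
proof (rule the_equality)
  show "inverts_mat A B \<and> inverts_mat B A" using assms by (simp add: inverts_mat_def)
next
  fix C assume C: "inverts_mat A C \<and> inverts_mat C A"
  \<comment> \<open>A competing inverse \<open>C\<close> comes without a carrier; its dimensions are
    read off from the identity matrices on the right-hand sides of
    \<open>inverts_mat\<close>.\<close>
  have "dim_col (A * C) = dim_row A" "dim_col (C * A) = dim_row C"
    using C unfolding inverts_mat_def by (metis index_one_mat(3))+
  then have c: "C \<in> carrier_mat n n" using assms(1) by auto
  have "C = C * (A * B)" using assms c by simp
  also have "\<dots> = C * A * B" using assms(1,2) c by (simp add: assoc_mult_mat[of _ n n _ n _ n] mult_carrier_mat[of _ n n _ n])
  also have "C * A = 1\<^sub>m n" using C c by (simp add: inverts_mat_def)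
  finally show "C = B" using assms(2) by simp
qed

lemma mat_inv_mat_diag:
  assumes "\<And>i. i < r \<Longrightarrow> d i * e i = (1::'a::comm_ring_1)"
  shows "mat_inv (mat_diag r d) = mat_diag r e"
proof (rule mat_inv_eqI[of _ r])
  show "mat_diag r d * mat_diag r e = 1\<^sub>m r" "mat_diag r e * mat_diag r d = 1\<^sub>m r"
    using assms by (auto simp: mult.commute) (auto simp: mat_diag_def one_mat_def mult.commute intro!: eq_matI)
qed simp_all

lemma dual_svdD:
  assumes "is_dual_svd n A U V r t \<mu>"
  shows "U \<in> carrier_mat n n" "V \<in> carrier_mat n n" "r \<le> t" "t \<le> n"
    "U * dual_adjoint U = 1\<^sub>m n" "dual_adjoint U * U = 1\<^sub>m n"
    "V * dual_adjoint V = 1\<^sub>m n" "dual_adjoint V * V = 1\<^sub>m n"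
    "\<And>i. i < r \<Longrightarrow> appreciable (complex_dual (\<mu> i))"
    "\<And>i. r \<le> i \<Longrightarrow> i < t \<Longrightarrow> infinitesimal (complex_dual (\<mu> i))"
  using assms
  by (auto simp: is_dual_svd_def dual_unitary_def inverts_mat_def appreciable_def
      infinitesimal_def)

lemma mat_inv_Sigma1:
  assumes "is_dual_svd n A U V r t \<mu>"
  shows "mat_inv (Sigma1 r \<mu>) = mat_diag r (\<lambda>i. dual_inv (complex_dual (\<mu> i)))"
  unfolding Sigma1_def using dual_svdD(9)[OF assms] by (intro mat_inv_mat_diag mult_dual_inv)

section \<open>Diagonal matrices between unitary factors\<close>

lemma unitary_conj_mult:
  assumes "P \<in> carrier_mat n n" "Q \<in> carrier_mat n n" "R \<in> carrier_mat n n"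
    "B \<in> carrier_mat n n" "C \<in> carrier_mat n n" "dual_adjoint Q * Q = 1\<^sub>m n"
  shows "(P * B * dual_adjoint Q) * (Q * C * dual_adjoint R) = P * (B * C) * dual_adjoint R"
proof -
  have "dual_adjoint Q * (Q * M) = M" if "M \<in> carrier_mat n n" for M
    using assms that by (subst assoc_mult_mat[symmetric, of _ n n _ n _ n]) auto
  then show ?thesis
    using assms(1-5) by (simp add: assoc_mult_mat[of _ n n _ n _ n] mult_carrier_mat[of _ n n _ n])
qed

lemma four_block_mat_diag:
  assumes "r \<le> n"
  shows "four_block_mat (mat_diag r d) (0\<^sub>m r (n - r)) (0\<^sub>m (n - r) r) (mat_diag (n - r) e) =
    mat_diag n (\<lambda>i. if i < r then d i else e (i - r))"
  using assms by (intro eq_matI) (auto simp: mat_diag_def)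

lemma mat_diag_dims [simp]: "dim_row (mat_diag n d) = n" "dim_col (mat_diag n d) = n"
  by (simp_all add: mat_diag_def)

lemma mat_diag_zero: "mat_diag n (\<lambda>_. 0) = 0\<^sub>m n n"
  by (rule eq_matI) (auto simp: mat_diag_def)

lemma dual_adjoint_mat_diag:
  "dual_adjoint (mat_diag n d) = mat_diag n (\<lambda>i. map_dual_num cnj (d i))"
  by (rule eq_matI) (auto simp: mat_diag_def dual_num_eq_iff)

lemma mat_diag_cong: "(\<And>i. i < n \<Longrightarrow> d i = e i) \<Longrightarrow> mat_diag n d = mat_diag n e"
  by (rule eq_matI) (auto simp: mat_diag_def)

abbreviation corner :: "nat \<Rightarrow> nat \<Rightarrow> 'a::zero mat \<Rightarrow> 'a mat" where
  "corner n r M \<equiv> four_block_mat M (0\<^sub>m r (n - r)) (0\<^sub>m (n - r) r) (0\<^sub>m (n - r) (n - r))"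

text \<open>All three matrices are diagonal between unitary factors, and the inner unitary factors
  cancel in products, so each equation reduces to one between diagonal entries.\<close>

lemma appreciable_split_dual_svd:
  assumes svd: "is_dual_svd n A U V r t \<mu>"
  shows "\<exists>F. appreciable_split n A (U * corner n r (Sigma1 r \<mu>) * dual_adjoint V) F
    (V * corner n r (mat_inv (Sigma1 r \<mu>)) * dual_adjoint U)"
proof -
  note D = dual_svdD[OF svd]
  let ?m = "\<lambda>i. complex_dual (\<mu> i)"
  \<comment> \<open>The diagonals of \<open>E\<close>, \<open>F\<close> and \<open>X\<close>, padded
    with zeros to length \<open>n\<close>. The supports of \<open>x\<close> and \<open>f\<close> are
    disjoint, which gives \<open>X * F = 0\<close> and \<open>F * X = 0\<close>.\<close>
  define d where "d = (\<lambda>i. if i < r then ?m i else 0)"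
  define f where "f = (\<lambda>i. if r \<le> i \<and> i < t then ?m i else 0)"
  define x where "x = (\<lambda>i. if i < r then dual_inv (?m i) else 0)"
  have r: "r \<le> n" using D by simp
  have E: "corner n r (Sigma1 r \<mu>) = mat_diag n d"
    using four_block_mat_diag[OF r] by (simp add: Sigma1_def d_def flip: mat_diag_zero)
  have X: "corner n r (mat_inv (Sigma1 r \<mu>)) = mat_diag n x"
    using four_block_mat_diag[OF r] by (simp add: mat_inv_Sigma1[OF svd] x_def flip: mat_diag_zero)
  have "four_block_mat (Sigma1 r \<mu>) (0\<^sub>m r (n - r)) (0\<^sub>m (n - r) r) (Sigma2 n r t \<mu>) =
      mat_diag n d + mat_diag n f"
    unfolding Sigma1_def Sigma2_def four_block_mat_diag[OF r] using D(3)
    by (intro eq_matI) (auto simp: mat_diag_def d_def f_def)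
  then have A: "A = U * (mat_diag n d + mat_diag n f) * dual_adjoint V"
    using svd by (simp add: is_dual_svd_def)
  \<comment> \<open>The projection onto the first \<open>r\<close> coordinates: \<open>E * X\<close>
    and \<open>X * E\<close> are its conjugates by \<open>U\<close> and by \<open>V\<close>, hence
    self-adjoint.\<close>
  define P :: "complex dual_num mat" where "P = mat_diag n (\<lambda>i. if i < r then 1 else 0)"
  have P [simp]: "P \<in> carrier_mat n n" by (simp add: P_def)
  have dx: "mat_diag n d * mat_diag n x = P" "mat_diag n x * mat_diag n d = P"
    "P * mat_diag n d = mat_diag n d" "P * mat_diag n x = mat_diag n x"
    unfolding P_def mat_diag_diag
    using D(9) by (auto intro!: mat_diag_cong simp: d_def x_def mult_dual_inv)
  have fx: "mat_diag n x * mat_diag n f = 0\<^sub>m n n" "mat_diag n f * mat_diag n x = 0\<^sub>m n n"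
    unfolding mat_diag_zero[symmetric] mat_diag_diag
    by (auto intro!: mat_diag_cong simp: x_def f_def)
  have "dual_adjoint P = P"
    unfolding P_def dual_adjoint_mat_diag by (rule mat_diag_cong) (simp add: dual_num_eq_iff)
  then have adj: "dual_adjoint (Q * P * dual_adjoint Q) = Q * P * dual_adjoint Q"
    if "Q \<in> carrier_mat n n" for Q
    using that by (simp add: dual_adjoint_mult[of _ n n _ n] assoc_mult_mat[of _ n n _ n _ n]
        mult_carrier_mat[of _ n n _ n])
  have "std_mat (mat_diag n f) = 0\<^sub>m n n"
    using D(10) by (intro eq_matI) (auto simp: mat_diag_def f_def infinitesimal_def)
  then have F: "std_mat (U * mat_diag n f * dual_adjoint V) = 0\<^sub>m n n"
    using D(1,2) by (simp add: std_mat_mult[of _ n n _ n] left_mult_zero_mat[of _ n n])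
  have "appreciable_split n A (U * mat_diag n d * dual_adjoint V)
      (U * mat_diag n f * dual_adjoint V) (V * mat_diag n x * dual_adjoint U)"
    unfolding appreciable_split_def
    using D(1,2) F A
    by (auto simp: mult_carrier_mat[of _ n n _ n] unitary_conj_mult[of _ n] D dx fx adj
        left_mult_zero_mat[of _ n n] right_mult_zero_mat[of _ n n]
        mult_add_distrib_mat[of _ n n _ n] add_mult_distrib_mat[of _ n n _ _ n]
        simp del: assoc_mult_mat mat_diag_diag)
  then show ?thesis unfolding E X by blast
qed

text \<open>Two definite descriptions are resolved in turn: the essential part by uniqueness of the
  splitting, then the NDMPI by uniqueness of the outer inverse.\<close>

lemma ndmpi_dual_svd:
  assumes A: "A \<in> carrier_mat n n" and svd: "is_dual_svd n A U V r t \<mu>"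
  shows "ndmpi A = V * corner n r (mat_inv (Sigma1 r \<mu>)) * dual_adjoint U"
proof -
  define E where "E = U * corner n r (Sigma1 r \<mu>) * dual_adjoint V"
  define X where "X = V * corner n r (mat_inv (Sigma1 r \<mu>)) * dual_adjoint U"
  obtain F where s: "appreciable_split n A E F X"
    using appreciable_split_dual_svd[OF svd] unfolding E_def X_def by blast
  have n: "dim_row A = n" "dim_col A = n" using A by auto
  have ess: "essential_part A = E"
    unfolding essential_part_def n
  proof (rule the_equality)
    show "\<exists>U V r t \<mu>. is_dual_svd n A U V r t \<mu> \<and>
        E = U * corner n r (Sigma1 r \<mu>) * dual_adjoint V"
      using svd E_def by blast
  next
    \<comment> \<open>The competing decomposition may use other unitary factors, other values of
      \<open>r\<close> and \<open>t\<close>, and other singular values; only the splitting it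
      induces matters.\<close>
    fix E'
    assume "\<exists>U V r t \<mu>. is_dual_svd n A U V r t \<mu> \<and>
        E' = U * corner n r (Sigma1 r \<mu>) * dual_adjoint V"
    then obtain F' X' where "appreciable_split n A E' F' X'"
      using appreciable_split_dual_svd by blast
    then show "E' = E" using s by (rule appreciable_split_unique)
  qed
  have c: "E \<in> carrier_mat n n" "X \<in> carrier_mat n n"
    and *: "E * X * E = E" "X * E * X = X" "dual_adjoint (E * X) = E * X"
      "dual_adjoint (X * E) = X * E"
    using s by (auto simp: appreciable_split_def)
  note AX = appreciable_split_mult[OF s]
  \<comment> \<open>Next to \<open>X\<close>, the matrix \<open>A\<close> acts as \<open>E\<close>,
    so the Moore-Penrose equations for \<open>E\<close> become the NDMPI equations for
    \<open>A\<close>.\<close>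
  have "A * X * A = E * (X * A)" unfolding AX(1) using A c by simp
  also have "\<dots> = E" unfolding AX(2) using c * by simp
  finally have AXA: "A * X * A = E" .
  have "ndmpi A = X"
    unfolding ndmpi_def n ess
  proof (rule the_equality)
    show "X \<in> carrier_mat n n \<and> A * X * A = E \<and> X * A * X = X \<and>
        dual_adjoint (A * X) = A * X \<and> dual_adjoint (X * A) = X * A"
      using c * AXA by (simp add: AX)
  next
    fix Y
    assume "Y \<in> carrier_mat n n \<and> A * Y * A = E \<and> Y * A * Y = Y \<and>
        dual_adjoint (A * Y) = A * Y \<and> dual_adjoint (Y * A) = Y * A"
    then have Y: "Y \<in> carrier_mat n n" "A * Y * A = A * X * A" "Y * A * Y = Y"
      "dual_adjoint (A * Y) = A * Y" "dual_adjoint (Y * A) = Y * A"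
      unfolding AXA by blast+
    show "Y = X"
      by (rule outer_inverse_unique[OF A Y(1) c(2) Y(2-5)]) (simp_all only: AX *)
  qed
  then show ?thesis unfolding X_def .
qed

section \<open>Block expansion\<close>

lemma dual_adjoint_four_block:
  assumes "K \<in> carrier_mat r r" "L \<in> carrier_mat r k" "M \<in> carrier_mat k r" "N \<in> carrier_mat k k"
  shows "dual_adjoint (four_block_mat K L M N) =
    four_block_mat (dual_adjoint K) (dual_adjoint M) (dual_adjoint L) (dual_adjoint N)"
  using assms by (intro eq_matI) auto

text \<open>Only the adjoint is separated into its two parts while \<open>S\<close> stays a dual
  matrix; this is the shape of the first formula for the NDMPI.\<close>

lemma dual_adjoint_mult_decomp:
  assumes "K \<in> carrier_mat r k" "S \<in> carrier_mat r m"
  shows "dual_adjoint K * S = lift_mat (mat_adjoint (std_mat K)) * S +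
    eps \<cdot>\<^sub>m (lift_mat (mat_adjoint (dual_mat K)) * S)"
proof -
  have c: "lift_mat (mat_adjoint (std_mat K)) \<in> carrier_mat k r"
    "lift_mat (mat_adjoint (dual_mat K)) \<in> carrier_mat k r"
    using assms(1) by simp_all
  show ?thesis
    unfolding dual_adjoint_def using c assms(2)
    by (simp add: add_mult_distrib_mat[of _ k r _ _ m] mult_smult_assoc_mat[of _ k r _ m])
qed

lemma mat_inv_std_mat_diag:
  fixes d :: "nat \<Rightarrow> 'a::field dual_num"
  assumes "\<And>i. i < r \<Longrightarrow> appreciable (d i)"
  shows "mat_inv (std_mat (mat_diag r d)) = mat_diag r (\<lambda>i. 1 / std_part (d i))"
proof -
  have "std_mat (mat_diag r d) = mat_diag r (\<lambda>i. std_part (d i))"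
    by (rule eq_matI) (auto simp: mat_diag_def)
  then show ?thesis
    using assms by (simp add: mat_inv_mat_diag appreciable_def)
qed

text \<open>Right multiplication by a diagonal matrix scales columns, so entrywise this is the
  product of a conjugated entry with 1/s - eps d/s^2. The last term produces the subtracted matrix
  in the second formula.\<close>

lemma dual_adjoint_mult_diag_inv:
  assumes K: "K \<in> carrier_mat r k" and d: "\<And>i. i < r \<Longrightarrow> appreciable (d i)"
  defines "S \<equiv> std_mat (mat_diag r d)"
  shows "dual_adjoint K * mat_diag r (\<lambda>i. dual_inv (d i)) =
    lift_mat (mat_adjoint (std_mat K) * mat_inv S) +
    eps \<cdot>\<^sub>m lift_mat (mat_adjoint (dual_mat K) * mat_inv S -
      mat_adjoint (std_mat K) * (mat_inv S ^\<^sub>m 2) * dual_mat (mat_diag r d))"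
proof -
  have c: "dual_adjoint K \<in> carrier_mat k r" "mat_adjoint (std_mat K) \<in> carrier_mat k r"
    "mat_adjoint (dual_mat K) \<in> carrier_mat k r"
    using K by simp_all
  have Sd: "dual_mat (mat_diag r d) = mat_diag r (\<lambda>i. dual_part (d i))"
    by (rule eq_matI) (auto simp: mat_diag_def)
  have Si: "mat_inv S = mat_diag r (\<lambda>i. 1 / std_part (d i))"
    unfolding S_def by (rule mat_inv_std_mat_diag[OF d])
  have Si2: "mat_diag r (\<lambda>i. 1 / std_part (d i)) ^\<^sub>m 2 = mat_diag r (\<lambda>i. 1 / (std_part (d i))\<^sup>2)"
    by (simp add: numeral_2_eq_2)
  show ?thesis
    unfolding Si Si2 Sd using K
    by (intro eq_matI)
      (auto simp: mat_diag_mult_right[OF c(1)] mat_diag_mult_right[OF c(2)]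
        mat_diag_mult_right[OF c(3)] mat_diag_mult_right[of _ k] dual_num_eq_iff dual_inv_def
        field_simps)
qed

section \<open>The block formulas for the NDMPI\<close>

theorem theorem4p2:
  fixes n r t :: nat
    and A U V :: "complex dual_num mat"
    and \<mu> :: "nat \<Rightarrow> real dual_num"
  defines "S1 \<equiv> Sigma1 r \<mu>"
  defines "S1s \<equiv> std_mat S1"
  defines "S1d \<equiv> dual_mat S1"
  assumes "A \<in> carrier_mat n n"
    and "r = arank A"
    and "is_dual_svd n A U V r t \<mu>"
  shows "\<exists>K1 \<in> carrier_mat r r. \<exists>K2 \<in> carrier_mat r r.
         \<exists>L1 \<in> carrier_mat r (n - r). \<exists>L2 \<in> carrier_mat r (n - r).
      K1 * mat_adjoint K1 + L1 * mat_adjoint L1 = 1\<^sub>m r \<and>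
      K1 * mat_adjoint K2 + K2 * mat_adjoint K1 + L1 * mat_adjoint L2 + L2 * mat_adjoint L1
        = 0\<^sub>m r r \<and>
      ndmpi A =
        U * (four_block_mat
               (lift_mat (mat_adjoint K1) * mat_inv S1) (0\<^sub>m r (n - r))
               (lift_mat (mat_adjoint L1) * mat_inv S1) (0\<^sub>m (n - r) (n - r))
             + eps \<cdot>\<^sub>m four_block_mat
               (lift_mat (mat_adjoint K2) * mat_inv S1) (0\<^sub>m r (n - r))
               (lift_mat (mat_adjoint L2) * mat_inv S1) (0\<^sub>m (n - r) (n - r)))
          * dual_adjoint U \<and>
      ndmpi A =
        U * (lift_mat (four_block_mat
               (mat_adjoint K1 * mat_inv S1s) (0\<^sub>m r (n - r))
               (mat_adjoint L1 * mat_inv S1s) (0\<^sub>m (n - r) (n - r)))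
             + eps \<cdot>\<^sub>m lift_mat (four_block_mat
               (mat_adjoint K2 * mat_inv S1s - mat_adjoint K1 * (mat_inv S1s ^\<^sub>m 2) * S1d)
               (0\<^sub>m r (n - r))
               (mat_adjoint L2 * mat_inv S1s - mat_adjoint L1 * (mat_inv S1s ^\<^sub>m 2) * S1d)
               (0\<^sub>m (n - r) (n - r))))
          * dual_adjoint U"
proof -
  note A = assms(4) and svd = assms(6)
  note D = dual_svdD[OF svd]
  have [simp]: "U \<in> carrier_mat n n" "V \<in> carrier_mat n n" by (fact D)+
  have r: "r \<le> n" using D by simp
  define Si where "Si = mat_inv S1"
  have S1: "S1 = mat_diag r (\<lambda>i. complex_dual (\<mu> i))" by (simp add: S1_def Sigma1_def)
  have Si: "Si = mat_diag r (\<lambda>i. dual_inv (complex_dual (\<mu> i)))"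
    unfolding Si_def S1_def by (rule mat_inv_Sigma1[OF svd])
  have Si_c [simp]: "Si \<in> carrier_mat r r" by (simp add: Si)
  \<comment> \<open>Since V equals \<open>U * dual_adjoint W\<close>, this matrix moves the left
    factor \<open>V\<close> of the NDMPI to \<open>U\<close>.\<close>
  define W where "W = dual_adjoint V * U"
  have W [simp]: "W \<in> carrier_mat n n" by (simp add: W_def mult_carrier_mat[of _ n n _ n])
  have Wa: "dual_adjoint W = dual_adjoint U * V"
    by (simp add: W_def dual_adjoint_mult[of _ n n _ n])
  have "W * dual_adjoint W = dual_adjoint V * (U * dual_adjoint U) * V"
    unfolding Wa unfolding W_def by (simp add: assoc_mult_mat[of _ n n _ n _ n] mult_carrier_mat[of _ n n _ n])
  then have WW: "W * dual_adjoint W = 1\<^sub>m n"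
    by (simp add: D right_mult_one_mat[of _ n n])
  obtain K L M N where split: "split_block W r r = (K, L, M, N)"
    by (metis prod_cases4)
  have W_blocks: "W = four_block_mat K L M N"
    and c [simp]: "K \<in> carrier_mat r r" "L \<in> carrier_mat r (n - r)"
      "M \<in> carrier_mat (n - r) r" "N \<in> carrier_mat (n - r) (n - r)"
    using split_block[OF split, of "n - r" "n - r"] W r by auto
  note c_dims [simp] = c[THEN carrier_matD(1)] c[THEN carrier_matD(2)]
  have Wa_blocks: "dual_adjoint W =
      four_block_mat (dual_adjoint K) (dual_adjoint M) (dual_adjoint L) (dual_adjoint N)"
    unfolding W_blocks by (rule dual_adjoint_four_block) (fact c)+
  \<comment> \<open>Orthonormality of the first \<open>r\<close> rows of \<open>W\<close>: the upper
    left block of \<open>W * dual_adjoint W = 1\<^sub>m n\<close>.\<close>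
  have KL: "K * dual_adjoint K + L * dual_adjoint L = 1\<^sub>m r"
  proof (rule eq_matI)
    fix i j assume ij: "i < dim_row (1\<^sub>m r)" "j < dim_col (1\<^sub>m r)"
    have "W * dual_adjoint W =
        four_block_mat (K * dual_adjoint K + L * dual_adjoint L)
          (K * dual_adjoint M + L * dual_adjoint N)
          (M * dual_adjoint K + N * dual_adjoint L) (M * dual_adjoint M + N * dual_adjoint N)"
      unfolding Wa_blocks unfolding W_blocks
      by (rule mult_four_block_mat[of _ r r _ "n - r" _ "n - r" _ _ r _ "n - r"]) simp_all
    then have "(K * dual_adjoint K + L * dual_adjoint L) $$ (i, j) = (W * dual_adjoint W) $$ (i, j)"
      using ij by simp
    then show "(K * dual_adjoint K + L * dual_adjoint L) $$ (i, j) = 1\<^sub>m r $$ (i, j)"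
      unfolding WW using ij r by simp
  qed (use c in auto)
  \<comment> \<open>The witnesses are the standard and dual parts of \<open>K\<close> and
    \<open>L\<close>; the two required relations are the two parts of \<open>KL\<close>.\<close>
  let ?K1 = "std_mat K" and ?K2 = "dual_mat K" and ?L1 = "std_mat L" and ?L2 = "dual_mat L"
  have "std_mat (K * dual_adjoint K + L * dual_adjoint L) =
      std_mat (K * dual_adjoint K) + std_mat (L * dual_adjoint L)"
    using c by (intro eq_matI) auto
  moreover have "std_mat (1\<^sub>m r :: complex dual_num mat) = 1\<^sub>m r"
    by (rule eq_matI) auto
  ultimately have std: "?K1 * mat_adjoint ?K1 + ?L1 * mat_adjoint ?L1 = 1\<^sub>m r"
    using KL by (simp add: std_mat_mult[of _ r r _ r] std_mat_mult[of _ r "n - r" _ r]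
        std_mat_dual_adjoint)
  have "dual_mat (K * dual_adjoint K + L * dual_adjoint L) =
      dual_mat (K * dual_adjoint K) + dual_mat (L * dual_adjoint L)"
    using c by (intro eq_matI) auto
  moreover have "dual_mat (1\<^sub>m r :: complex dual_num mat) = 0\<^sub>m r r"
    by (rule eq_matI) auto
  ultimately have dual: "?K1 * mat_adjoint ?K2 + ?K2 * mat_adjoint ?K1 +
      ?L1 * mat_adjoint ?L2 + ?L2 * mat_adjoint ?L1 = 0\<^sub>m r r"
    using KL by (simp add: dual_mat_mult[of _ r r _ r] dual_mat_mult[of _ r "n - r" _ r]
        std_mat_dual_adjoint dual_mat_dual_adjoint assoc_add_mat[of _ r r] add_carrier_mat
        mult_carrier_mat[of _ r r _ r] mult_carrier_mat[of _ r "n - r" _ r])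
  define Z where "Z = four_block_mat (dual_adjoint K * Si) (0\<^sub>m r (n - r))
      (dual_adjoint L * Si) (0\<^sub>m (n - r) (n - r))"
  have C: "corner n r Si \<in> carrier_mat n n"
    using r by (intro carrier_matI) (simp_all add: Si mat_diag_def)
  \<comment> \<open>The zero rows of the corner matrix cancel the adjoints of \<open>M\<close> and
    \<open>N\<close>, so only \<open>K\<close> and \<open>L\<close> survive.\<close>
  have "Z = dual_adjoint W * corner n r Si"
    unfolding Wa_blocks Z_def
    by (subst mult_four_block_mat[of _ r r _ "n - r" _ "n - r" _ _ r _ "n - r"])
      (simp_all add: right_mult_zero_mat[of _ _ "n - r"] right_mult_zero_mat[of _ _ r]
        right_add_zero_mat[of _ r r] right_add_zero_mat[of _ "n - r" r]
        mult_carrier_mat[of _ r r _ r] mult_carrier_mat[of _ "n - r" r _ r])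
  then have "U * Z * dual_adjoint U = (U * dual_adjoint U) * V * corner n r Si * dual_adjoint U"
    unfolding Wa using C by (simp add: assoc_mult_mat[of _ n n _ n _ n] mult_carrier_mat[of _ n n _ n])
  then have ndmpi: "ndmpi A = U * Z * dual_adjoint U"
    unfolding ndmpi_dual_svd[OF A svd] by (simp add: D left_mult_one_mat[of _ n n] Si_def S1_def)
  have Z1: "Z = four_block_mat
        (lift_mat (mat_adjoint ?K1) * mat_inv S1) (0\<^sub>m r (n - r))
        (lift_mat (mat_adjoint ?L1) * mat_inv S1) (0\<^sub>m (n - r) (n - r))
      + eps \<cdot>\<^sub>m four_block_mat
        (lift_mat (mat_adjoint ?K2) * mat_inv S1) (0\<^sub>m r (n - r))
        (lift_mat (mat_adjoint ?L2) * mat_inv S1) (0\<^sub>m (n - r) (n - r))"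
    unfolding Z_def dual_adjoint_mult_decomp[OF c(1) Si_c] dual_adjoint_mult_decomp[OF c(2) Si_c]
      Si_def[symmetric]
    \<comment> \<open>Products stay folded: the two sides are compared block by block, without
      expanding entries into scalar products.\<close>
    using Si_c c by (intro eq_matI) (auto simp del: index_mult_mat(1))
  have app: "\<And>i. i < r \<Longrightarrow> appreciable (complex_dual (\<mu> i))" by (fact D)
  have Z2: "Z = lift_mat (four_block_mat
        (mat_adjoint ?K1 * mat_inv S1s) (0\<^sub>m r (n - r))
        (mat_adjoint ?L1 * mat_inv S1s) (0\<^sub>m (n - r) (n - r)))
      + eps \<cdot>\<^sub>m lift_mat (four_block_mat
        (mat_adjoint ?K2 * mat_inv S1s - mat_adjoint ?K1 * (mat_inv S1s ^\<^sub>m 2) * S1d)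
        (0\<^sub>m r (n - r))
        (mat_adjoint ?L2 * mat_inv S1s - mat_adjoint ?L1 * (mat_inv S1s ^\<^sub>m 2) * S1d)
        (0\<^sub>m (n - r) (n - r)))"
  proof -
    have K: "dual_adjoint K * Si = lift_mat (mat_adjoint ?K1 * mat_inv S1s) + eps \<cdot>\<^sub>m
        lift_mat (mat_adjoint ?K2 * mat_inv S1s - mat_adjoint ?K1 * (mat_inv S1s ^\<^sub>m 2) * S1d)"
      and L: "dual_adjoint L * Si = lift_mat (mat_adjoint ?L1 * mat_inv S1s) + eps \<cdot>\<^sub>m
        lift_mat (mat_adjoint ?L2 * mat_inv S1s - mat_adjoint ?L1 * (mat_inv S1s ^\<^sub>m 2) * S1d)"
      unfolding Si S1d_def S1s_def S1
      by (rule dual_adjoint_mult_diag_inv[OF c(1) app] dual_adjoint_mult_diag_inv[OF c(2) app];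
        assumption)+
    \<comment> \<open>\<open>mat_inv\<close> is a definite description, so its dimensions become
      visible only once the inverse is evaluated as a diagonal matrix.\<close>
    have dims: "dim_col (mat_inv S1s) = r" "dim_col S1d = r"
      by (simp_all add: S1s_def S1d_def S1 mat_inv_std_mat_diag[OF app])
    show ?thesis
      unfolding Z_def K L
      using dims c by (intro eq_matI) (auto simp: dual_num_eq_iff simp del: index_mult_mat(1))
  qed
  have "?K1 \<in> carrier_mat r r" "?K2 \<in> carrier_mat r r"
    "?L1 \<in> carrier_mat r (n - r)" "?L2 \<in> carrier_mat r (n - r)"
    by simp_all
  then show ?thesis
    using std dual ndmpi[unfolded Z1] ndmpi[unfolded Z2] by blast
qed

end
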